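(* For every monotonic (non-decreasing or non-increasing) sequence of speeds $(s_i)_{i\ge2}$ with $s_i\ge1$, the algorithm $\mathcal{S}$-DC is not competitive for the infinite server problem on the half-line $[0,\infty)$ with source $0$.
   Context: Infinite server problem on the half-line $[0,\infty)$ with source $0$: an unbounded number of servers initially reside at $0$; requests are revealed one by one and must be served immediately, without knowledge of future requests, by moving a server to the request; the cost is the total distance traveled. With $\mathcal{S}=\{s_i : i\ge2\}$, denote by $x_i$ the $i$-th server from the right. Algorithm $\mathcal{S}$-DC: if a request lies between servers $x_{i+1}$ (to its left) and $x_i$ (to its right), move them towards it with speeds $s_{i+1}$ and $1$ respectively until one of them reaches it; if no server is to the right of the request, move the rightmost server to the request. An online algorithm is competitive if there are $\rho,c$ with $ALG(\sigma)\le\rho\,OPT(\sigma)+c$ for all request sequences $\sigma$. *)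

theory Defs
  imports Main "HOL.Real"
begin

text \<open>Configurations of the online algorithm: x i is the position of the i-th server
from the right (i \<ge> 1); index 0 is unused. Initially all servers are at the source 0.
Speeds: s i for i \<ge> 2 (the rightmost server x 1 always has speed 1).\<close>

definition dc_step :: "(nat \<Rightarrow> real) \<Rightarrow> (nat \<Rightarrow> real) \<Rightarrow> real \<Rightarrow> (nat \<Rightarrow> real) \<times> real" where
  "dc_step s x r =
    (if \<exists>i\<ge>1. x i = r then (x, 0)
     else if x 1 < r then (x(1 := r), r - x 1)
     else (let i = (THE i. 1 \<le> i \<and> x (Suc i) < r \<and> r < x i);
               t = min ((r - x (Suc i)) / s (Suc i)) (x i - r)
           in (x(Suc i := x (Suc i) + s (Suc i) * t, i := x i - t), (s (Suc i) + 1) * t)))"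

fun dc_cost :: "(nat \<Rightarrow> real) \<Rightarrow> (nat \<Rightarrow> real) \<Rightarrow> real list \<Rightarrow> real" where
  "dc_cost s x [] = 0"
| "dc_cost s x (r # rs) = snd (dc_step s x r) + dc_cost s (fst (dc_step s x r)) rs"

definition ALG_DC :: "(nat \<Rightarrow> real) \<Rightarrow> real list \<Rightarrow> real" where
  "ALG_DC s \<sigma> = dc_cost s (\<lambda>_. 0) \<sigma>"

text \<open>Offline schedules: C k j is the position of server j after serving the first k
requests; all servers start at 0, stay on the half-line, only finitely many ever move,
and after serving request k some server is at that request.\<close>
definition opt_feasible :: "real list \<Rightarrow> (nat \<Rightarrow> nat \<Rightarrow> real) \<Rightarrow> bool" where
  "opt_feasible \<sigma> C \<longleftrightarrow>
     (\<forall>j. C 0 j = 0) \<and> (\<forall>k j. 0 \<le> C k j) \<and> finite {j. \<exists>k. C k j \<noteq> 0} \<and>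
     (\<forall>k < length \<sigma>. \<exists>j. C (Suc k) j = \<sigma> ! k)"

definition opt_cost :: "real list \<Rightarrow> (nat \<Rightarrow> nat \<Rightarrow> real) \<Rightarrow> real" where
  "opt_cost \<sigma> C = (\<Sum>k<length \<sigma>. \<Sum>j\<in>{j. \<exists>k. C k j \<noteq> 0}. \<bar>C (Suc k) j - C k j\<bar>)"

definition OPT :: "real list \<Rightarrow> real" where
  "OPT \<sigma> = Inf {opt_cost \<sigma> C | C. opt_feasible \<sigma> C}"

definition competitive :: "(real list \<Rightarrow> real) \<Rightarrow> bool" where
  "competitive ALG \<longleftrightarrow>
     (\<exists>\<rho> c::real. \<forall>\<sigma>. (\<forall>r\<in>set \<sigma>. 0 \<le> r) \<longrightarrow> ALG \<sigma> \<le> \<rho> * OPT \<sigma> + c)"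

end

theory Submission
  imports Defs Complex_Main
begin

text \<open>
Suppose the offline servers stand at \<open>x\<^sub>a > x\<^sub>a\<^sub>+\<^sub>1 > \<dots> > x\<^sub>b\<close>, the positions of the online servers
\<open>a, \<dots>, b\<close>. If the offline server at \<open>x\<^sub>a\<close> moves left by a small \<open>e\<close> and the requests
\<open>x\<^sub>a - e, x\<^sub>a\<^sub>+\<^sub>1, \<dots>, x\<^sub>b\<close> follow, then each online server in turn is pulled off its place and back
again, the perturbation of server \<open>i\<close> being \<open>e s\<^sub>a\<^sub>+\<^sub>1 \<cdots> s\<^sub>i\<close>. In the end only server \<open>a\<close>
(by \<open>-e\<close>) and server \<open>b + 1\<close> (by \<open>e s\<^sub>a\<^sub>+\<^sub>1 \<cdots> s\<^sub>b\<^sub>+\<^sub>1\<close>) have moved, the offline cost is \<open>e\<close>, and the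
online cost is at least \<open>e (s\<^sub>a\<^sub>+\<^sub>1 + s\<^sub>a\<^sub>+\<^sub>1 s\<^sub>a\<^sub>+\<^sub>2 + \<dots>)\<close>. Repeating this drags server \<open>b + 1\<close>
from the source to a point just left of \<open>x\<^sub>b\<close>.

If the speeds tend to 1, take \<open>a = 1\<close> with server 1 placed far to the right, so that it can give way
all the time. Dragging server \<open>n + 1\<close> to distance about 1 then costs the offline algorithm \<open>O(1)\<close>,
but the online algorithm at least \<open>\<Sum>\<^sub>k s\<^sub>2 \<cdots> s\<^sub>k / (s\<^sub>2 \<cdots> s\<^sub>n\<^sub>+\<^sub>1)\<close>, which is unbounded in \<open>n\<close>.

Otherwise monotonicity gives \<open>s\<^sub>i \<ge> c > 1\<close> for all large \<open>i\<close>. Then \<open>h\<close> offline servers suffice: they form a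
window \<open>a, \<dots>, a + h - 1\<close> at spacing \<open>g = 4 / c\<^sup>h\<close>. Dragging server \<open>a + h\<close> over distance about 1 needs a
retreat of \<open>x\<^sub>a\<close> by less than \<open>g\<close>, and moving the offline server from there to the new position of
server \<open>a + h\<close> advances the window at cost \<open>O(h g)\<close>. There is room for about \<open>1 / g\<close> such steps, so the
offline cost is \<open>O(h)\<close> while the online cost is of order \<open>c\<^sup>h\<close>.

Scaling the instance removes the additive constant.
\<close>

section \<open>Offline schedules\<close>

text \<open>Only a set of positions known to be occupied is tracked, not the individual servers. It need
not contain the source, from which \<open>spawn\<close> takes a fresh server.\<close>

inductive serves :: "real set \<Rightarrow> real list \<Rightarrow> real \<Rightarrow> real set \<Rightarrow> bool" where
  stop: "S' \<subseteq> S \<Longrightarrow> serves S [] 0 S'"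
| request: "r \<in> S \<Longrightarrow> serves S \<sigma> d S' \<Longrightarrow> serves S (r # \<sigma>) d S'"
| move: "u \<in> S \<Longrightarrow> 0 \<le> v \<Longrightarrow> serves (insert v (S - {u})) \<sigma> d S' \<Longrightarrow>
    serves S \<sigma> (d + \<bar>u - v\<bar>) S'"
| spawn: "0 \<le> v \<Longrightarrow> serves (insert v S) \<sigma> d S' \<Longrightarrow> serves S \<sigma> (d + v) S'"

lemma serves_mono: "serves S \<sigma> d S' \<Longrightarrow> S \<subseteq> R \<Longrightarrow> serves R \<sigma> d S'"
proof (induction arbitrary: R rule: serves.induct)
  case (stop S' S)
  then show ?case by (intro serves.stop) auto
next
  case (request r S \<sigma> d S')
  then show ?case by (intro serves.request) auto
next
  case (move u S v \<sigma> d S')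
  have "serves (insert v (R - {u})) \<sigma> d S'" using move.prems by (intro move.IH) auto
  then show ?case using move.hyps move.prems by (intro serves.move) auto
next
  case (spawn v S \<sigma> d S')
  have "serves (insert v R) \<sigma> d S'" using spawn.prems by (intro spawn.IH) auto
  then show ?case using spawn.hyps by (intro serves.spawn)
qed

lemma serves_append:
  "serves S \<sigma> d S' \<Longrightarrow> serves S' \<tau> e R \<Longrightarrow> serves S (\<sigma> @ \<tau>) (d + e) R"
proof (induction rule: serves.induct)
  case (stop S' S)
  then show ?case by (auto intro: serves_mono)
next
  case (request r S \<sigma> d S')
  then show ?case by (auto intro: serves.request)
next
  case (move u S v \<sigma> d S')
  then show ?case using serves.move[of u S v "\<sigma> @ \<tau>" "d + e" R] by (simp add: algebra_simps)
next
  case (spawn v S \<sigma> d S')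
  then show ?case using serves.spawn[of v S "\<sigma> @ \<tau>" "d + e" R] by (simp add: algebra_simps)
qed

lemma serves_requests: "set \<sigma> \<subseteq> S \<Longrightarrow> serves S \<sigma> 0 S"
  by (induction \<sigma>) (auto intro: serves.intros)

lemma serves_scale:
  assumes "L > 0"
  shows "serves S \<sigma> d S' \<Longrightarrow> serves ((*) L ` S) (map ((*) L) \<sigma>) (L * d) ((*) L ` S')"
proof (induction rule: serves.induct)
  case (stop S' S)
  then show ?case by (auto intro: serves.stop)
next
  case (request r S \<sigma> d S')
  then show ?case by (auto intro: serves.request)
next
  case (move u S v \<sigma> d S')
  have "inj ((*) L)" using assms by (auto intro: injI)
  then have "(*) L ` insert v (S - {u}) = insert (L * v) ((*) L ` S - {L * u})"
    by (auto simp: image_set_diff)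
  then have "serves ((*) L ` S) (map ((*) L) \<sigma>) (L * d + \<bar>L * u - L * v\<bar>) ((*) L ` S')"
    using move assms by (intro serves.move) auto
  moreover have "\<bar>L * u - L * v\<bar> = L * \<bar>u - v\<bar>"
    using assms by (simp add: abs_mult flip: right_diff_distrib)
  ultimately show ?case by (simp add: distrib_left)
next
  case (spawn v S \<sigma> d S')
  then have "serves ((*) L ` S) (map ((*) L) \<sigma>) (L * d + L * v) ((*) L ` S')"
    using assms by (intro serves.spawn) auto
  then show ?case by (simp add: distrib_left)
qed

text \<open>Relaxes \<open>opt_feasible\<close> to an arbitrary start \<open>p\<close>, as an
  induction over \<open>serves\<close> needs. \<open>J\<close> may be any finite set containing all
  servers that are ever off the source, so different schedules can be summed over a common index
  set.\<close>

definition schedule :: "(nat \<Rightarrow> real) \<Rightarrow> real list \<Rightarrow> real \<Rightarrow> (nat \<Rightarrow> nat \<Rightarrow> real) \<Rightarrow> nat set \<Rightarrow> bool" where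
  "schedule p \<sigma> d C J \<longleftrightarrow>
    C 0 = p \<and> finite J \<and> (\<forall>k j. 0 \<le> C k j) \<and> (\<forall>k j. C k j \<noteq> 0 \<longrightarrow> j \<in> J) \<and>
    (\<forall>k < length \<sigma>. \<exists>j. C (Suc k) j = \<sigma> ! k) \<and>
    (\<Sum>k<length \<sigma>. \<Sum>j\<in>J. \<bar>C (Suc k) j - C k j\<bar>) \<le> d"

text \<open>The preliminary move is merged into the first time step: only the start of
  \<open>C\<close> is replaced, and the triangle inequality charges the move to that step.\<close>

lemma schedule_move_first:
  assumes "schedule (p(i := v)) \<sigma> d C J" and p: "\<And>j. 0 \<le> p j"
  shows "schedule p \<sigma> (d + \<bar>p i - v\<bar>) (C(0 := p)) (insert i J)"
proof -
  from assms have C0: "C 0 = p(i := v)" and fin: "finite J" and nn: "\<And>k j. 0 \<le> C k j"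
    and supp: "\<And>k j. C k j \<noteq> 0 \<Longrightarrow> j \<in> J"
    and srv: "\<And>k. k < length \<sigma> \<Longrightarrow> \<exists>j. C (Suc k) j = \<sigma> ! k"
    and cost: "(\<Sum>k<length \<sigma>. \<Sum>j\<in>J. \<bar>C (Suc k) j - C k j\<bar>) \<le> d"
    by (auto simp: schedule_def)
  let ?J = "insert i J" and ?C = "C(0 := p)"
  have ext: "(\<Sum>j\<in>?J. \<bar>C (Suc k) j - C k j\<bar>) = (\<Sum>j\<in>J. \<bar>C (Suc k) j - C k j\<bar>)" for k
  proof -
    have "C (Suc k) i = C k i" if "i \<notin> J" using supp that by metis
    then show ?thesis using fin by (simp add: sum.insert_if)
  qed
  have "(\<Sum>k<length \<sigma>. \<Sum>j\<in>?J. \<bar>?C (Suc k) j - ?C k j\<bar>) \<le> d + \<bar>p i - v\<bar>"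
  proof (cases \<sigma>)
    case Nil
    then show ?thesis using cost by simp
  next
    case (Cons r \<tau>)
    have "(\<Sum>j\<in>?J. \<bar>C 1 j - p j\<bar>) \<le>
        (\<Sum>j\<in>?J. \<bar>C 1 j - C 0 j\<bar> + (if j = i then \<bar>p i - v\<bar> else 0))"
      by (intro sum_mono) (auto simp: C0)
    also have "\<dots> = (\<Sum>j\<in>?J. \<bar>C 1 j - C 0 j\<bar>) + \<bar>p i - v\<bar>"
      using fin by (simp add: sum.distrib)
    finally have "(\<Sum>k<length \<sigma>. \<Sum>j\<in>?J. \<bar>?C (Suc k) j - ?C k j\<bar>) \<le>
        (\<Sum>k<length \<sigma>. \<Sum>j\<in>?J. \<bar>C (Suc k) j - C k j\<bar>) + \<bar>p i - v\<bar>"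
      using Cons by (simp only: sum.lessThan_Suc_shift length_Cons) (simp add: algebra_simps)
    also have "\<dots> \<le> d + \<bar>p i - v\<bar>"
      using cost by (simp only: ext)
    finally show ?thesis .
  qed
  moreover have "j \<in> ?J" if "p j \<noteq> 0" for j
    using supp[of 0 j] that by (cases "j = i") (auto simp: C0)
  ultimately show ?thesis
    using fin nn supp srv p unfolding schedule_def by auto
qed

lemma serves_schedule:
  assumes "serves S \<sigma> d S'" "S \<subseteq> range p" "\<And>j. 0 \<le> p j" "finite {j. p j \<noteq> 0}"
  shows "\<exists>C J. schedule p \<sigma> d C J"
  using assms
proof (induction arbitrary: p rule: serves.induct)
  case (stop S' S)
  then have "schedule p [] 0 (\<lambda>_. p) {j. p j \<noteq> 0}" by (auto simp: schedule_def)
  then show ?case by blast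
next
  case (request r S \<sigma> d S')
  then obtain C J where C: "schedule p \<sigma> d C J" by blast
  let ?C = "\<lambda>k. case k of 0 \<Rightarrow> p | Suc k \<Rightarrow> C k"
  obtain i where i: "r = p i" using request by blast
  have "\<exists>j. ?C (Suc k) j = (r # \<sigma>) ! k" if "k < length (r # \<sigma>)" for k
    using that i C by (cases k) (auto simp: schedule_def)
  moreover have "(\<Sum>k<length (r # \<sigma>). \<Sum>j\<in>J. \<bar>?C (Suc k) j - ?C k j\<bar>) \<le> d"
    using C by (simp only: sum.lessThan_Suc_shift length_Cons) (simp add: schedule_def)
  moreover have "0 \<le> ?C k j \<and> (?C k j \<noteq> 0 \<longrightarrow> j \<in> J)" for k j
    using C request.prems(2)[of j] by (cases k) (auto simp: schedule_def)
  moreover have "finite J" using C by (simp add: schedule_def)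
  ultimately have "schedule p (r # \<sigma>) d ?C J"
    by (simp add: schedule_def del: sum.lessThan_Suc)
  then show ?case by blast
next
  case (move u S v \<sigma> d S')
  then obtain i where i: "u = p i" by blast
  have "insert v (S - {u}) \<subseteq> range (p(i := v))"
    using move.prems(1) i by (auto simp: image_iff)
  moreover have "finite {j. (p(i := v)) j \<noteq> 0}"
    by (rule finite_subset[of _ "insert i {j. p j \<noteq> 0}"]) (auto simp: move)
  ultimately obtain C J where "schedule (p(i := v)) \<sigma> d C J"
    using move.IH[of "p(i := v)"] move.hyps move.prems by fastforce
  from schedule_move_first[OF this move.prems(2)] i show ?case by blast
next
  case (spawn v S \<sigma> d S')
  have inf: "infinite {j. p j = 0}"
    using spawn.prems(3) finite_Collect_not by auto
  then obtain i where i: "p i = 0" by (metis (mono_tags, lifting) empty_Collect_eq finite.emptyI)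
  \<comment> \<open>A second server at the source: if \<open>0 \<in> S\<close>, that position must
    stay occupied after server \<open>i\<close> has left.\<close>
  have "infinite ({j. p j = 0} - {i})" using inf by simp
  then obtain i' where i': "p i' = 0" "i' \<noteq> i"
    by (metis (mono_tags, lifting) DiffE ex_in_conv finite.emptyI insertCI mem_Collect_eq)
  have "w \<in> range (p(i := v))" if "w \<in> range p" for w
  proof -
    obtain j where j: "w = p j" using \<open>w \<in> range p\<close> by blast
    have "w = (p(i := v)) (if j = i then i' else j)" using i i' j by simp
    then show ?thesis by blast
  qed
  then have "insert v S \<subseteq> range (p(i := v))"
    using spawn.prems(1) by (auto simp: image_iff)
  moreover have "finite {j. (p(i := v)) j \<noteq> 0}"
    by (rule finite_subset[of _ "insert i {j. p j \<noteq> 0}"]) (auto simp: spawn)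
  ultimately obtain C J where "schedule (p(i := v)) \<sigma> d C J"
    using spawn.IH[of "p(i := v)"] spawn.hyps spawn.prems by fastforce
  from schedule_move_first[OF this spawn.prems(2)] i spawn.hyps show ?case by auto
qed

text \<open>The schedule obtained from \<open>serves\<close> is a feasible offline solution. It also
  makes the infimum one of a nonempty set, which the bound from below needs, and places every
  request on the half-line.\<close>

lemma OPT_bounds:
  assumes "serves {} \<sigma> d S'"
  shows "0 \<le> OPT \<sigma>" "OPT \<sigma> \<le> d" "\<forall>r\<in>set \<sigma>. 0 \<le> r"
proof -
  obtain C J where C: "schedule (\<lambda>_. 0) \<sigma> d C J"
    using serves_schedule[OF assms, of "\<lambda>_. 0"] by auto
  let ?A = "{opt_cost \<sigma> C | C. opt_feasible \<sigma> C}"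
  let ?T = "{j. \<exists>k. C k j \<noteq> 0}"
  have sub: "?T \<subseteq> J" and "finite J" using C by (auto simp: schedule_def)
  then have fin: "finite ?T" by (rule finite_subset)
  with C have feas: "opt_feasible \<sigma> C" by (auto simp: opt_feasible_def schedule_def)
  have "(\<Sum>j\<in>J. \<bar>C (Suc k) j - C k j\<bar>) = (\<Sum>j\<in>?T. \<bar>C (Suc k) j - C k j\<bar>)" for k
    using sub \<open>finite J\<close> by (intro sum.mono_neutral_right) auto
  then have le: "opt_cost \<sigma> C \<le> d" using C by (simp add: opt_cost_def schedule_def)
  have nn: "0 \<le> z" if "z \<in> ?A" for z
    using that by (auto simp: opt_cost_def intro!: sum_nonneg)
  have "OPT \<sigma> \<le> opt_cost \<sigma> C"
    unfolding OPT_def using feas nn by (intro cInf_lower) (auto simp: bdd_below_def)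
  with le show "OPT \<sigma> \<le> d" by simp
  show "0 \<le> OPT \<sigma>"
    unfolding OPT_def using feas nn by (intro cInf_greatest) auto
  show "\<forall>r\<in>set \<sigma>. 0 \<le> r"
  proof
    fix r assume "r \<in> set \<sigma>"
    then obtain k where "k < length \<sigma>" "r = \<sigma> ! k" by (auto simp: in_set_conv_nth)
    moreover from this obtain j where "C (Suc k) j = \<sigma> ! k"
      using feas unfolding opt_feasible_def by blast
    moreover have "0 \<le> C (Suc k) j" using feas unfolding opt_feasible_def by blast
    ultimately show "0 \<le> r" by simp
  qed
qed

section \<open>Runs of the online algorithm\<close>

fun dc_end :: "(nat \<Rightarrow> real) \<Rightarrow> (nat \<Rightarrow> real) \<Rightarrow> real list \<Rightarrow> nat \<Rightarrow> real" where
  "dc_end s x [] = x"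
| "dc_end s x (r # \<sigma>) = dc_end s (fst (dc_step s x r)) \<sigma>"

lemma dc_end_append: "dc_end s x (\<sigma> @ \<tau>) = dc_end s (dc_end s x \<sigma>) \<tau>"
  by (induction \<sigma> arbitrary: x) auto

lemma dc_cost_append: "dc_cost s x (\<sigma> @ \<tau>) = dc_cost s x \<sigma> + dc_cost s (dc_end s x \<sigma>) \<tau>"
  by (induction \<sigma> arbitrary: x) auto

text \<open>A positive factor preserves all comparisons, so the same case and the same pair of
  servers are selected, and the time \<open>t\<close> is multiplied by \<open>L\<close>.\<close>

lemma dc_step_scale:
  assumes L: "L > 0"
  shows "dc_step s (\<lambda>i. L * x i) (L * r) =
    ((\<lambda>i. L * fst (dc_step s x r) i), L * snd (dc_step s x r))"
proof (cases "(\<exists>i\<ge>1. x i = r) \<or> x 1 < r")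
  case True
  then show ?thesis
    using L by (auto simp: dc_step_def fun_eq_iff right_diff_distrib)
next
  case False
  define i where "i = (THE i. 1 \<le> i \<and> x (Suc i) < r \<and> r < x i)"
  define t where "t = min ((r - x (Suc i)) / s (Suc i)) (x i - r)"
  have i: "i = (THE i. 1 \<le> i \<and> L * x (Suc i) < L * r \<and> L * r < L * x i)"
    using L by (simp add: i_def)
  have t: "min ((L * r - L * x (Suc i)) / s (Suc i)) (L * x i - L * r) = L * t"
    using L by (simp add: t_def min_mult_distrib_left right_diff_distrib)
  have "dc_step s x r = (x(Suc i := x (Suc i) + s (Suc i) * t, i := x i - t), (s (Suc i) + 1) * t)"
    unfolding dc_step_def Let_def i_def[symmetric] t_def[symmetric] using False by auto
  moreover have "dc_step s (\<lambda>i. L * x i) (L * r) =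
      ((\<lambda>i. L * x i)(Suc i := L * x (Suc i) + s (Suc i) * (L * t), i := L * x i - L * t),
       (s (Suc i) + 1) * (L * t))"
    unfolding dc_step_def Let_def i[symmetric] t using False L by auto
  ultimately show ?thesis by (auto simp: fun_eq_iff algebra_simps)
qed

lemma dc_cost_scale:
  assumes "L > 0"
  shows "dc_cost s (\<lambda>i. L * x i) (map ((*) L) \<sigma>) = L * dc_cost s x \<sigma>"
  by (induction \<sigma> arbitrary: x) (simp_all add: dc_step_scale[OF assms] distrib_left)

text \<open>Scaling by \<open>L\<close> turns the surplus \<open>1\<close> into
  \<open>L > c\<close>, which the additive constant cannot absorb. Passing to
  \<open>\<bar>R\<bar>\<close> allows the upper bound on \<open>OPT\<close> to be multiplied by the
  ratio.\<close>

lemma not_competitive_if_unbounded_ratio: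
  assumes "\<And>R. \<exists>\<sigma> d S'. serves {} \<sigma> d S' \<and> R * d + 1 \<le> ALG_DC s \<sigma>"
  shows "\<not> competitive (ALG_DC s)"
proof
  assume "competitive (ALG_DC s)"
  then obtain R c where comp: "\<And>\<sigma>. (\<forall>r\<in>set \<sigma>. 0 \<le> r) \<Longrightarrow> ALG_DC s \<sigma> \<le> R * OPT \<sigma> + c"
    unfolding competitive_def by blast
  obtain \<sigma> d S' where \<sigma>: "serves {} \<sigma> d S'" "\<bar>R\<bar> * d + 1 \<le> ALG_DC s \<sigma>"
    using assms by blast
  define L where "L = \<bar>c\<bar> + 1"
  have L: "L > 0" by (simp add: L_def)
  let ?\<sigma> = "map ((*) L) \<sigma>"
  have srv: "serves {} ?\<sigma> (L * d) ((*) L ` S')"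
    using serves_scale[OF L \<sigma>(1)] by simp
  note B = OPT_bounds[OF this]
  have "L * (\<bar>R\<bar> * d + 1) \<le> L * ALG_DC s \<sigma>" using \<sigma>(2) L by simp
  also have "\<dots> = ALG_DC s ?\<sigma>"
    using dc_cost_scale[OF L, of s "\<lambda>_. 0" \<sigma>] by (simp add: ALG_DC_def)
  also have "\<dots> \<le> R * OPT ?\<sigma> + c" by (rule comp[OF B(3)])
  also have "R * OPT ?\<sigma> \<le> \<bar>R\<bar> * OPT ?\<sigma>" using B(1) by (intro mult_right_mono) auto
  also have "\<dots> \<le> \<bar>R\<bar> * (L * d)" using B(2) by (intro mult_left_mono) auto
  finally show False using L by (simp add: algebra_simps L_def)
qed

text \<open>A phase of the game played on pairs of offline positions and online configuration, with
  the requests hidden. The offline expense is \<open>d\<close>, while \<open>a\<close> only bounds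
  the online cost from below; phases compose by adding both.\<close>

definition forces :: "(nat \<Rightarrow> real) \<Rightarrow> real set \<Rightarrow> (nat \<Rightarrow> real) \<Rightarrow> real \<Rightarrow> real \<Rightarrow>
    real set \<Rightarrow> (nat \<Rightarrow> real) \<Rightarrow> bool" where
  "forces s S x d a S' x' \<longleftrightarrow>
    (\<exists>\<sigma>. serves S \<sigma> d S' \<and> dc_end s x \<sigma> = x' \<and> a \<le> dc_cost s x \<sigma>)"

lemma forces_trans:
  assumes "forces s S x d a S' x'" "forces s S' x' e b S'' x''"
  shows "forces s S x (d + e) (a + b) S'' x''"
proof -
  obtain \<sigma> \<tau> where "serves S \<sigma> d S'" "dc_end s x \<sigma> = x'" "a \<le> dc_cost s x \<sigma>"
    "serves S' \<tau> e S''" "dc_end s x' \<tau> = x''" "b \<le> dc_cost s x' \<tau>"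
    using assms by (auto simp: forces_def)
  then show ?thesis
    unfolding forces_def
    by (intro exI[of _ "\<sigma> @ \<tau>"]) (auto simp: dc_end_append dc_cost_append intro: serves_append)
qed

lemma forces_move:
  assumes "u \<in> S" "0 \<le> v" "S' \<subseteq> insert v (S - {u})"
  shows "forces s S x \<bar>u - v\<bar> 0 S' x"
  using serves.move[OF assms(1,2) serves.stop[OF assms(3)]]
  unfolding forces_def by (intro exI[of _ "[]"]) auto

lemma forces_spawn:
  assumes "0 \<le> v" "S' \<subseteq> insert v S"
  shows "forces s S x v 0 S' x"
  using serves.spawn[OF assms(1) serves.stop[OF assms(2)]]
  unfolding forces_def by (intro exI[of _ "[]"]) auto

section \<open>Pushing a pair of neighbouring online servers\<close>

definition sorted_conf :: "(nat \<Rightarrow> real) \<Rightarrow> bool" where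
  "sorted_conf x \<longleftrightarrow> (\<forall>i\<ge>1. x (Suc i) \<le> x i)"

lemma sorted_confD:
  assumes "sorted_conf x" "1 \<le> i" "i \<le> j"
  shows "x j \<le> x i"
  using assms(3)
proof (induction rule: dec_induct)
  case (step j)
  have "x (Suc j) \<le> x j" using assms(1,2) step.hyps by (simp add: sorted_conf_def)
  with step.IH show ?case by simp
qed simp

text \<open>Server \<open>i\<close> needs time \<open>e\<close> to reach \<open>r\<close>; by
  \<open>gap\<close>, server \<open>Suc i\<close> does not pass \<open>r\<close> in that time. So
  the right server determines the length of the step.\<close>

lemma dc_step_push:
  assumes x: "sorted_conf x" and i: "1 \<le> i" and e: "0 < e" "x i = r + e"
    and s: "0 < s (Suc i)" and gap: "s (Suc i) * e \<le> r - x (Suc i)"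
  shows "dc_step s x r = (x(i := r, Suc i := x (Suc i) + s (Suc i) * e), (s (Suc i) + 1) * e)"
proof -
  have lt: "x (Suc i) < r" "r < x i"
    using gap e mult_pos_pos[OF s e(1)] by auto
  \<comment> \<open>The weak inequalities serve both the \<open>THE\<close> and, below, the claim
    that no server already stands at \<open>r\<close>.\<close>
  have unique: "j = i" if "1 \<le> j" "x (Suc j) \<le> r" "r \<le> x j" for j
  proof (rule ccontr)
    assume "j \<noteq> i"
    then consider "j \<ge> Suc i" | "Suc j \<le> i" by linarith
    then show False
      using sorted_confD[OF x, of "Suc i" j] sorted_confD[OF x, of "Suc j" i] that lt i
      by cases auto
  qed
  have "\<not> (\<exists>j\<ge>1. x j = r)"
  proof
    assume "\<exists>j\<ge>1. x j = r"
    then obtain j where j: "j \<ge> 1" "x j = r" by blast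
    show False
      using unique[of j] sorted_confD[OF x, of j "Suc j"] j lt by auto
  qed
  moreover have "\<not> x 1 < r" using sorted_confD[OF x _ i] lt by auto
  moreover have "(THE i. 1 \<le> i \<and> x (Suc i) < r \<and> r < x i) = i"
    using i lt by (intro the_equality) (auto intro!: unique)
  moreover have "min ((r - x (Suc i)) / s (Suc i)) (x i - r) = e"
    using gap s e(2) by (simp add: min_def field_simps)
  ultimately show ?thesis
    unfolding dc_step_def using e by (auto simp: fun_eq_iff Let_def)
qed

section \<open>Dragging a server out of the source\<close>

text \<open>The product \<open>s (i+1) * ... * s (i+n)\<close>, unfolded from the front because a
  chain starting at \<open>i\<close> continues as one starting at \<open>Suc i\<close>.\<close>

fun speed_prod :: "(nat \<Rightarrow> real) \<Rightarrow> nat \<Rightarrow> nat \<Rightarrow> real" where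
  "speed_prod s i 0 = 1"
| "speed_prod s i (Suc n) = s (Suc i) * speed_prod s (Suc i) n"

text \<open>Horner form of the sum of \<open>speed_prod s i k\<close> over
  \<open>1 \<le> k \<le> n\<close>.\<close>

fun speed_sum :: "(nat \<Rightarrow> real) \<Rightarrow> nat \<Rightarrow> nat \<Rightarrow> real" where
  "speed_sum s i 0 = 0"
| "speed_sum s i (Suc n) = s (Suc i) * (1 + speed_sum s (Suc i) n)"

lemma speed_prod_Suc: "speed_prod s i (Suc n) = speed_prod s i n * s (Suc (i + n))"
  by (induction n arbitrary: i) (auto simp: mult_ac)

lemma speed_sum_Suc: "speed_sum s i (Suc n) = speed_sum s i n + speed_prod s i (Suc n)"
proof (induction n arbitrary: i)
  case (Suc n)
  have "speed_sum s i (Suc (Suc n)) = s (Suc i) * (1 + speed_sum s (Suc i) (Suc n))" by simp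
  also have "\<dots> = s (Suc i) * (1 + speed_sum s (Suc i) n) + s (Suc i) * speed_prod s (Suc i) (Suc n)"
    by (simp only: Suc.IH) (simp add: algebra_simps)
  finally show ?case by simp
qed simp


lemma speed_prod_ge_1: "(\<And>j. 2 \<le> j \<Longrightarrow> 1 \<le> s j) \<Longrightarrow> 1 \<le> i \<Longrightarrow> 1 \<le> speed_prod s i n"
proof (induction n arbitrary: i)
  case (Suc n)
  then have "1 \<le> s (Suc i)" "1 \<le> speed_prod s (Suc i) n" by simp_all
  then show ?case using mult_mono[of 1 "s (Suc i)" 1 "speed_prod s (Suc i) n"] by simp
qed simp

text \<open>Serving \<open>r\<close> pushes server \<open>Suc i\<close> off its place by
  \<open>s (Suc i) * e\<close>; requesting that old place recreates the situation one index further,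
  with the new displacement in the role of \<open>e\<close>. Speeds of at least 1 make the last
  displacement the largest, so bounding it by the gap \<open>\<delta>\<close> covers all
  steps.\<close>

lemma dc_chain:
  assumes s: "\<And>j. 2 \<le> j \<Longrightarrow> 1 \<le> s j"
    and "sorted_conf x" "1 \<le> i" "0 < e" "x i = r + e"
    and "e * speed_prod s i (Suc n) \<le> \<delta>" "\<delta> \<le> r - x (Suc i)"
    and "\<And>k. 1 \<le> k \<Longrightarrow> k \<le> n \<Longrightarrow> \<delta> \<le> x (i + k) - x (Suc (i + k))"
  defines "x' \<equiv> x(i := r, Suc (i + n) := x (Suc (i + n)) + e * speed_prod s i (Suc n))"
  shows "dc_end s x (r # map x [Suc i..<Suc (i + n)]) = x'"
    and "e * speed_sum s i (Suc n) \<le> dc_cost s x (r # map x [Suc i..<Suc (i + n)])"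
proof -
  have "dc_end s x (r # map x [Suc i..<Suc (i + n)]) =
      x(i := r, Suc (i + n) := x (Suc (i + n)) + e * speed_prod s i (Suc n)) \<and>
    e * speed_sum s i (Suc n) \<le> dc_cost s x (r # map x [Suc i..<Suc (i + n)])"
    using assms(2-8)
  proof (induction n arbitrary: x i e r)
    case 0
    have "1 \<le> s (Suc i)" using s 0 by simp
    with 0 have "dc_step s x r = (x(i := r, Suc i := x (Suc i) + s (Suc i) * e), (s (Suc i) + 1) * e)"
      by (intro dc_step_push) (auto simp: mult.commute)
    then show ?case using 0 by (auto simp: algebra_simps fun_eq_iff)
  next
    case (Suc n)
    have s1: "1 \<le> s (Suc i)" using s Suc.prems by simp
    let ?e = "s (Suc i) * e"
    let ?x = "x(i := r, Suc i := x (Suc i) + ?e)"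
    have e: "0 < ?e" using s1 Suc.prems by simp
    have "?e * 1 \<le> ?e * speed_prod s (Suc i) (Suc n)"
      using e s by (intro mult_left_mono speed_prod_ge_1) auto
    then have le: "?e \<le> \<delta>" using Suc.prems(5) by (simp add: mult_ac)
    have step: "dc_step s x r = (?x, (s (Suc i) + 1) * e)"
      using Suc.prems s1 le by (intro dc_step_push) auto
    have "?x (Suc j) \<le> ?x j" if "j \<ge> 1" for j
    proof -
      have "x (Suc j) \<le> x j" using Suc.prems(1) that by (simp add: sorted_conf_def)
      then show ?thesis using Suc.prems le e by auto
    qed
    then have sorted: "sorted_conf ?x" by (simp add: sorted_conf_def)
    have gaps: "\<delta> \<le> ?x (Suc i + k) - ?x (Suc (Suc i + k))" if "1 \<le> k" "k \<le> n" for k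
      using Suc.prems(7)[of "Suc k"] that by simp
    have gap: "\<delta> \<le> x (Suc i) - ?x (Suc (Suc i))"
      using Suc.prems(7)[of 1] by simp
    have e_le: "?e * speed_prod s (Suc i) (Suc n) \<le> \<delta>"
      using Suc.prems(5) by (simp add: mult_ac)
    have IH: "dc_end s ?x (x (Suc i) # map ?x [Suc (Suc i)..<Suc (Suc i + n)]) =
        ?x(Suc i := x (Suc i), Suc (Suc i + n) := ?x (Suc (Suc i + n)) + ?e * speed_prod s (Suc i) (Suc n)) \<and>
      ?e * speed_sum s (Suc i) (Suc n) \<le> dc_cost s ?x (x (Suc i) # map ?x [Suc (Suc i)..<Suc (Suc i + n)])"
      by (rule Suc.IH[OF sorted _ e _ e_le gap gaps]) simp_all
    have "[Suc i..<Suc (i + Suc n)] = Suc i # [Suc (Suc i)..<Suc (Suc i + n)]"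
      using upt_conv_Cons[of "Suc i" "Suc (i + Suc n)"] by simp
    then have "map x [Suc i..<Suc (i + Suc n)] =
        x (Suc i) # map ?x [Suc (Suc i)..<Suc (Suc i + n)]"
      by simp
    with step IH have
      "dc_end s x (r # map x [Suc i..<Suc (i + Suc n)]) =
        ?x(Suc i := x (Suc i), Suc (Suc i + n) := ?x (Suc (Suc i + n)) + ?e * speed_prod s (Suc i) (Suc n))"
      "(s (Suc i) + 1) * e + ?e * speed_sum s (Suc i) (Suc n) \<le>
        dc_cost s x (r # map x [Suc i..<Suc (i + Suc n)])"
      by (simp_all del: upt_Suc speed_prod.simps speed_sum.simps)
    moreover have "e * speed_sum s i (Suc (Suc n)) \<le>
        (s (Suc i) + 1) * e + ?e * speed_sum s (Suc i) (Suc n)"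
      using Suc.prems(3) by (simp add: algebra_simps)
    ultimately show ?case by (auto simp: fun_eq_iff mult_ac)
  qed
  then show "dc_end s x (r # map x [Suc i..<Suc (i + n)]) = x'"
    and "e * speed_sum s i (Suc n) \<le> dc_cost s x (r # map x [Suc i..<Suc (i + n)])"
    by (auto simp: x'_def)
qed

text \<open>After one offline move of length \<open>e\<close>, all requests of the chain are
  occupied positions. The displaced server \<open>Suc (a + n)\<close> lies outside the window, so
  the offline positions again coincide with the online servers \<open>a\<close> to
  \<open>a + n\<close>.\<close>

lemma forces_pass:
  assumes s: "\<And>j. 2 \<le> j \<Longrightarrow> 1 \<le> s j"
    and x: "sorted_conf x" and a: "1 \<le> a" and e: "0 < e" "e \<le> x a"
    and \<delta>: "e * speed_prod s a (Suc n) \<le> \<delta>" "\<delta> \<le> x a - e - x (Suc a)"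
      "\<And>k. 1 \<le> k \<Longrightarrow> k \<le> n \<Longrightarrow> \<delta> \<le> x (a + k) - x (Suc (a + k))"
    and x': "x' = x(a := x a - e, Suc (a + n) := x (Suc (a + n)) + e * speed_prod s a (Suc n))"
  shows "forces s (x ` {a..a+n}) x e (e * speed_sum s a (Suc n)) (x' ` {a..a+n}) x'"
proof -
  let ?\<sigma> = "(x a - e) # map x [Suc a..<Suc (a + n)]"
  have "0 < e * speed_prod s a (Suc n)"
    using speed_prod_ge_1[of s a "Suc n"] s a e by (intro mult_pos_pos) fastforce+
  then have lt: "x (Suc a) < x a" using \<delta> e by linarith
  \<comment> \<open>An offline move deletes a position from a set, so no other server of the window
    may share the place \<open>x a\<close>.\<close>
  have notin: "x j \<noteq> x a" if "Suc a \<le> j" for j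
    using sorted_confD[OF x _ that] lt by auto
  have img: "x' ` {a..a+n} \<subseteq> insert (x a - e) (x ` {a..a+n} - {x a})"
  proof
    fix w assume "w \<in> x' ` {a..a+n}"
    then obtain j where "a \<le> j" "j \<le> a + n" "w = x' j" by auto
    then show "w \<in> insert (x a - e) (x ` {a..a+n} - {x a})"
      using notin[of j] by (cases "j = a") (auto simp: x')
  qed
  have "set ?\<sigma> \<subseteq> x' ` {a..a+n}"
  proof -
    have "x a - e = x' a" by (simp add: x')
    moreover have "x j = x' j" if "Suc a \<le> j" "j < Suc (a + n)" for j
      using that by (simp add: x')
    ultimately show ?thesis by (auto simp del: upt_Suc)
  qed
  then have "serves (x' ` {a..a+n}) ?\<sigma> 0 (x' ` {a..a+n})" by (rule serves_requests)
  then have "serves (insert (x a - e) (x ` {a..a+n} - {x a})) ?\<sigma> 0 (x' ` {a..a+n})"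
    using img by (rule serves_mono)
  then have "serves (x ` {a..a+n}) ?\<sigma> (0 + \<bar>x a - (x a - e)\<bar>) (x' ` {a..a+n})"
    using e by (intro serves.move) auto
  moreover have "dc_end s x ?\<sigma> = x'" "e * speed_sum s a (Suc n) \<le> dc_cost s x ?\<sigma>"
    using dc_chain[OF s x a e(1) _ \<delta>] by (simp_all add: x')
  ultimately show ?thesis using e unfolding forces_def by (intro exI[of _ ?\<sigma>]) simp
qed

text \<open>\<open>K\<close> passes with \<open>e = T / K\<close>; all of them keep the gaps at least \<open>\<delta>\<close> once \<open>K\<close> is large, and after
\<open>j\<close> passes the configuration is the convex combination \<open>z j\<close> of \<open>x\<close> and \<open>y\<close>.\<close>

lemma forces_stage:
  assumes s: "\<And>j. 2 \<le> j \<Longrightarrow> 1 \<le> s j"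
    and x: "sorted_conf x" and a: "1 \<le> a" and T: "0 < T" "T \<le> x a"
    and v: "v = x (Suc (a + n)) + T * speed_prod s a (Suc n)"
    and y: "y = x(a := x a - T, Suc (a + n) := v)"
    and gap: "\<And>k. k \<le> n \<Longrightarrow> y (Suc (a + k)) < y (a + k)"
  shows "forces s (x ` {a..a+n}) x T (T * speed_sum s a (Suc n)) (y ` {a..a+n}) y" "sorted_conf y"
proof -
  define P where "P = speed_prod s a (Suc n)"
  have P: "1 \<le> P" using speed_prod_ge_1[of s a "Suc n"] s a unfolding P_def by blast
  have v: "v = x (Suc (a + n)) + T * P" and "0 < T * P"
    using v P T by (auto simp: P_def)
  have above: "x i \<le> y i" if "i \<noteq> a" for i
    using that \<open>0 < T * P\<close> by (auto simp: y v)
  have same: "y i = x i" if "a < i" "i \<le> a + n" for i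
    using that by (auto simp: y)
  have "y (Suc i) \<le> y i" if "i \<ge> 1" for i
  proof (cases "a \<le> i \<and> i \<le> a + n")
    case True
    then obtain k where "i = a + k" "k \<le> n" by (auto simp: le_iff_add)
    then show ?thesis using gap[of k] by simp
  next
    case False
    have "x (Suc i) \<le> x i" using x that by (simp add: sorted_conf_def)
    moreover have "y (Suc i) \<le> x (Suc i)" using False T by (auto simp: y)
    ultimately show ?thesis using above[of i] False by fastforce
  qed
  then show sorted_y: "sorted_conf y" by (simp add: sorted_conf_def)
  \<comment> \<open>The smallest gap of the final configuration. During the passes server
    \<open>a\<close> is never left of \<open>y a\<close>, server \<open>Suc (a + n)\<close> never
    right of its goal, and those between are back in place after each pass, so
    \<open>\<delta>\<close> bounds the gaps before every pass.\<close>
  define \<delta> where "\<delta> = Min ((\<lambda>k. y (a + k) - y (Suc (a + k))) ` {..n})"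
  have "\<delta> > 0" using gap unfolding \<delta>_def by (subst Min_gr_iff) auto
  have \<delta>: "\<delta> \<le> y (a + k) - y (Suc (a + k))" if "k \<le> n" for k
    unfolding \<delta>_def using that by (intro Min_le) auto
  obtain K :: nat where K: "T * P / \<delta> < K" using reals_Archimedean2 by blast
  moreover have "0 < T * P / \<delta>" using \<open>0 < T * P\<close> \<open>\<delta> > 0\<close> by simp
  ultimately have Kpos: "0 < real K" by linarith
  define e where "e = T / K"
  have e: "0 < e" "e * P \<le> \<delta>"
    using K Kpos T \<open>\<delta> > 0\<close> by (auto simp: e_def field_simps)
  define z where "z j i = x i + (real j / K) * (y i - x i)" for j i
  have "forces s (x ` {a..a+n}) x (real j * e) (real j * (e * speed_sum s a (Suc n))) (z j ` {a..a+n}) (z j)"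
    if "j \<le> K" for j
    using that
  proof (induction j)
    case 0
    have "z 0 = x" by (simp add: z_def fun_eq_iff)
    then show ?case
      using serves.stop[of "x ` {a..a+n}"] unfolding forces_def by (intro exI[of _ "[]"]) auto
  next
    case (Suc j)
    define t where "t = real j / K"
    have zc: "z j i = (1 - t) * x i + t * y i" for i
      by (simp add: z_def algebra_simps flip: t_def)
    have t: "0 \<le> t" "t \<le> 1" using Suc.prems Kpos by (auto simp: t_def)
    have sorted_z: "z j (Suc i) \<le> z j i" if "i \<ge> 1" for i
    proof -
      have "(1 - t) * x (Suc i) + t * y (Suc i) \<le> (1 - t) * x i + t * y i"
        using t x sorted_y that by (intro add_mono mult_left_mono) (auto simp: sorted_conf_def)
      then show ?thesis by (simp only: zc)
    qed
    have below: "z j i \<le> y i" if "i \<noteq> a" for i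
    proof -
      have "t * (y i - x i) \<le> 1 * (y i - x i)"
        using t above[OF that] by (intro mult_right_mono) auto
      then show ?thesis by (simp add: zc algebra_simps)
    qed
    have za: "z j a - e = x a - T * (real (Suc j) / K)"
      using Kpos by (simp add: z_def y e_def field_simps)
    have "T * (real (Suc j) / K) \<le> T * 1"
      using Suc.prems T Kpos by (intro mult_left_mono) auto
    then have ya: "y a \<le> z j a - e" unfolding za by (simp add: y)
    have same': "z j i = y i" if "a < i" "i \<le> a + n" for i
      using same[OF that] by (simp add: z_def)
    have "z (Suc j) = (z j)(a := z j a - e, Suc (a + n) := z j (Suc (a + n)) + e * P)"
      using za Kpos by (auto simp: fun_eq_iff z_def y v e_def field_simps)
    then have "forces s (z j ` {a..a+n}) (z j) e (e * speed_sum s a (Suc n))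
        (z (Suc j) ` {a..a+n}) (z (Suc j))"
    proof (intro forces_pass[of s "z j" a e n \<delta>, OF s _ a e(1)])
      show "sorted_conf (z j)" using sorted_z by (simp add: sorted_conf_def)
      show "e \<le> z j a" using ya T by (simp add: y)
      show "\<delta> \<le> z j a - e - z j (Suc a)"
        using ya below[of "Suc a"] \<delta>[of 0] by simp
      show "\<delta> \<le> z j (a + k) - z j (Suc (a + k))" if "1 \<le> k" "k \<le> n" for k
        using same'[of "a + k"] below[of "Suc (a + k)"] \<delta>[of k] that by simp
    qed (use e in \<open>simp_all add: P_def\<close>)
    from forces_trans[OF Suc.IH this] Suc.prems show ?case by (simp add: algebra_simps)
  qed
  from this[of K] have "forces s (x ` {a..a+n}) x (K * e) (K * (e * speed_sum s a (Suc n)))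
      (z K ` {a..a+n}) (z K)" by simp
  moreover have "z K = y" "real K * e = T" using Kpos by (auto simp: z_def fun_eq_iff e_def)
  ultimately show "forces s (x ` {a..a+n}) x T (T * speed_sum s a (Suc n)) (y ` {a..a+n}) y"
    by (simp only: mult.assoc[symmetric])
qed

section \<open>Spreading the servers out and sliding the window\<close>

lemma forces_weaken:
  assumes "forces s S x d a S' x'" "b \<le> a" "R \<subseteq> S'"
  shows "forces s S x d b R x'"
proof -
  obtain \<sigma> where "serves S \<sigma> d S'" "dc_end s x \<sigma> = x'" "a \<le> dc_cost s x \<sigma>"
    using assms(1) by (auto simp: forces_def)
  then show ?thesis
    using serves_append[OF _ serves.stop[OF assms(3)], of S \<sigma> d] assms(2)
    unfolding forces_def by (intro exI[of _ \<sigma>]) auto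
qed

lemma speed_sum_nonneg: "(\<And>j. 2 \<le> j \<Longrightarrow> 1 \<le> s j) \<Longrightarrow> 1 \<le> i \<Longrightarrow> 0 \<le> speed_sum s i n"
proof (induction n)
  case (Suc n)
  then show ?case
    using speed_prod_ge_1[of s i "Suc n"] unfolding speed_sum_Suc by fastforce
qed simp

text \<open>Each round drags the next server from the source into \<open>[1, 2]\<close> while server
  1 retreats, then sends a fresh offline server after it. Retreat \<open>T\<close> and distance
  \<open>v\<close> are at most 2, so a round costs offline at most 4; starting server 1 at
  \<open>M\<close> leaves room for all retreats.\<close>

lemma forces_spread:
  fixes g M :: real
  assumes s: "\<And>j. 2 \<le> j \<Longrightarrow> 1 \<le> s j" and g: "0 < g" "real (n + 1) * g \<le> 1"
    and M: "2 * real n + 4 \<le> M"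
  shows "\<exists>x d. forces s {} (\<lambda>_. 0) d (\<Sum>k<n. speed_sum s 1 (Suc k) / speed_prod s 1 (Suc k))
      (x ` {1..1+n}) x \<and> sorted_conf x \<and> d \<le> M + 4 * real n \<and> M - 2 * real n \<le> x 1 \<and>
    (\<forall>i. 2 \<le> i \<and> i \<le> 1 + n \<longrightarrow> x i = 2 - real i * g) \<and> (\<forall>i. 1 + n < i \<longrightarrow> x i = 0)"
  using g(2) M
proof (induction n)
  case 0
  define x where "x = (\<lambda>_::nat. 0 :: real)(1 := M)"
  have "dc_step s (\<lambda>_. 0) M = (x, M)" using 0 by (auto simp: dc_step_def x_def)
  moreover have "serves {} [M] (0 + M) {M}"
    using 0 by (intro serves.spawn serves.request serves.stop) auto
  moreover have "x ` {1..1+0} = {M}" by (simp add: x_def)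
  ultimately have "forces s {} (\<lambda>_. 0) M 0 (x ` {1..1+0}) x"
    using 0 unfolding forces_def by (intro exI[of _ "[M]"]) simp
  moreover have "x 1 = M" "\<And>i. 1 < i \<Longrightarrow> x i = 0" by (simp_all add: x_def)
  moreover have "sorted_conf x" using 0 by (simp add: sorted_conf_def x_def)
  ultimately show ?case
    using 0 by (intro exI[of _ x] exI[of _ M] conjI) simp_all
next
  case (Suc n)
  have "real (n + 1) * g \<le> real (Suc n + 1) * g" using g by (intro mult_right_mono) auto
  then have "real (n + 1) * g \<le> 1" using Suc.prems by simp
  with Suc obtain x d where
    x: "forces s {} (\<lambda>_. 0) d (\<Sum>k<n. speed_sum s 1 (Suc k) / speed_prod s 1 (Suc k)) (x ` {1..1+n}) x"
    "sorted_conf x" "d \<le> M + 4 * real n" "M - 2 * real n \<le> x 1"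
    and mid: "\<And>i. 2 \<le> i \<Longrightarrow> i \<le> 1 + n \<Longrightarrow> x i = 2 - real i * g"
    and zero: "\<And>i. 1 + n < i \<Longrightarrow> x i = 0"
    by auto
  define P where "P = speed_prod s 1 (Suc n)"
  have P: "1 \<le> P" unfolding P_def using s by (intro speed_prod_ge_1) auto
  define v where "v = 2 - real (n + 2) * g"
  have v: "1 \<le> v" "v \<le> 2" using Suc.prems g by (auto simp: v_def)
  \<comment> \<open>A total retreat of \<open>T\<close> moves the dragged server by
    \<open>T * P\<close>, here from 0 to \<open>v\<close>.\<close>
  define T where "T = v / P"
  have T: "0 < T" "T \<le> 2" using v P by (auto simp: T_def divide_le_eq)
  define y where "y = x(1 := x 1 - T, Suc (1 + n) := v)"
  have v': "v = x (Suc (1 + n)) + T * speed_prod s 1 (Suc n)"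
    using zero[of "Suc (1 + n)"] P by (simp add: T_def del: speed_prod.simps One_nat_def flip: P_def)
  have y_mid: "y i = 2 - real i * g" if "2 \<le> i" "i \<le> 2 + n" for i
    using mid[of i] that by (auto simp: y_def v_def)
  have y1: "y 1 = x 1 - T" by (simp add: y_def)
  have gap: "y (Suc (1 + k)) < y (1 + k)" if "k \<le> n" for k
  proof (cases k)
    case 0
    have "y 2 < 2" using g y_mid[of 2] by simp
    moreover have "4 \<le> y 1" using x(4) Suc.prems T y1 by simp
    ultimately show ?thesis using 0 by (simp add: numeral_2_eq_2)
  next
    case (Suc m)
    then show ?thesis
      using y_mid[of "1 + k"] y_mid[of "Suc (1 + k)"] that g by (simp add: algebra_simps)
  qed
  have "T \<le> x 1" using x(4) Suc.prems T by simp
  note stage = forces_stage[OF s x(2) _ T(1) this v' y_def gap]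
  have "y (Suc (1 + n)) = v" by (simp add: y_def)
  moreover have "{1..1 + Suc n} = insert (Suc (1 + n)) {1..1+n}" by auto
  ultimately have "y ` {1..1 + Suc n} \<subseteq> insert v (y ` {1..1+n})" by auto
  then have "forces s (y ` {1..1+n}) y v 0 (y ` {1..1 + Suc n}) y"
    using v by (intro forces_spawn) auto
  with x(1) stage(1) have
    "forces s {} (\<lambda>_. 0) (d + T + v)
      ((\<Sum>k<n. speed_sum s 1 (Suc k) / speed_prod s 1 (Suc k)) + T * speed_sum s 1 (Suc n) + 0)
      (y ` {1..1 + Suc n}) y"
    by (intro forces_trans) auto
  moreover have "speed_sum s 1 (Suc n) / speed_prod s 1 (Suc n) \<le> T * speed_sum s 1 (Suc n)"
  proof -
    have "0 \<le> speed_sum s 1 (Suc n)" using s by (intro speed_sum_nonneg) auto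
    then have "1 * speed_sum s 1 (Suc n) \<le> v * speed_sum s 1 (Suc n)"
      using v by (intro mult_right_mono)
    then show ?thesis
      unfolding T_def P_def[symmetric] times_divide_eq_left mult_1
      using P by (intro divide_right_mono) auto
  qed
  ultimately have "forces s {} (\<lambda>_. 0) (d + T + v)
      (\<Sum>k<Suc n. speed_sum s 1 (Suc k) / speed_prod s 1 (Suc k)) (y ` {1..1 + Suc n}) y"
    by (elim forces_weaken) (simp_all del: speed_sum.simps speed_prod.simps)
  moreover have "sorted_conf y" using stage(2) by simp
  moreover have "d + T + v \<le> M + 4 * real (Suc n)" using x(3) T v by simp
  moreover have "M - 2 * real (Suc n) \<le> y 1" using x(4) T y1 by simp
  moreover have "\<forall>i. 1 + Suc n < i \<longrightarrow> y i = 0" using zero by (simp add: y_def)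
  ultimately show ?case using y_mid by (intro exI[of _ y] exI[of _ "d + T + v"]) auto
qed

text \<open>Each round drags server \<open>Suc (a + m)\<close> out of the source and then moves the
  offline server at the right end of the window to it. Hypothesis \<open>P\<close> keeps the retreat
  below \<open>g\<close>, so server \<open>a\<close> stays right of its neighbour.\<close>

lemma forces_slide:
  fixes g :: real
  assumes s: "\<And>j. 2 \<le> j \<Longrightarrow> 1 \<le> s j" and g: "0 < g" "real (N + Suc m + J) * g \<le> 1"
    and N: "1 \<le> N" and P: "\<And>a. N \<le> a \<Longrightarrow> 2 / speed_prod s a (Suc m) < g"
    and x: "sorted_conf x" "\<And>i. N \<le> i \<Longrightarrow> i \<le> N + m \<Longrightarrow> x i = 2 - real i * g"
      "\<And>i. N + m < i \<Longrightarrow> x i = 0"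
  shows "\<exists>y. forces s (x ` {N..N+m}) x (real J * (real (Suc m) * g)) (real J)
      (y ` {N+J..N+J+m}) y \<and> sorted_conf y \<and>
    (\<forall>i. N + J \<le> i \<and> i \<le> N + J + m \<longrightarrow> y i = 2 - real i * g) \<and> (\<forall>i. N + J + m < i \<longrightarrow> y i = 0)"
  using g(2)
proof (induction J)
  case 0
  have "forces s (x ` {N..N+m}) x 0 0 (x ` {N..N+m}) x"
    using serves.stop[of "x ` {N..N+m}"] unfolding forces_def by (intro exI[of _ "[]"]) auto
  then show ?case using x by (intro exI[of _ x]) auto
next
  case (Suc J)
  define a where "a = N + J"
  have "real (N + Suc m + J) * g \<le> real (N + Suc m + Suc J) * g"
    using g by (intro mult_right_mono) auto
  with Suc obtain z where
    z: "forces s (x ` {N..N+m}) x (real J * (real (Suc m) * g)) (real J) (z ` {a..a+m}) z"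
    "sorted_conf z" and mid: "\<And>i. a \<le> i \<Longrightarrow> i \<le> a + m \<Longrightarrow> z i = 2 - real i * g"
    and zero: "\<And>i. a + m < i \<Longrightarrow> z i = 0"
    unfolding a_def by auto
  define P where "P = speed_prod s a (Suc m)"
  have P1: "1 \<le> P" unfolding P_def using s N by (intro speed_prod_ge_1) (auto simp: a_def)
  have "2 / P < g" using P[of a] by (simp add: P_def a_def)
  define v where "v = 2 - real (Suc (a + m)) * g"
  have v: "1 \<le> v" "v \<le> 2" using Suc.prems g by (auto simp: v_def a_def algebra_simps)
  define T where "T = v / P"
  have "T \<le> 2 / P" unfolding T_def using v P1 by (intro divide_right_mono) auto
  then have T: "0 < T" "T < g" using v P1 \<open>2 / P < g\<close> by (auto simp: T_def)
  define y where "y = z(a := z a - T, Suc (a + m) := v)"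
  have v': "v = z (Suc (a + m)) + T * speed_prod s a (Suc m)"
    using zero[of "Suc (a + m)"] P1 by (simp add: T_def del: speed_prod.simps flip: P_def)
  have y_mid: "y i = 2 - real i * g" if "Suc a \<le> i" "i \<le> Suc (a + m)" for i
    using mid[of i] that by (auto simp: y_def v_def)
  have ya: "y a = 2 - real a * g - T" using mid[of a] by (simp add: y_def)
  have gap: "y (Suc (a + k)) < y (a + k)" if "k \<le> m" for k
  proof (cases k)
    case 0
    then show ?thesis using y_mid[of "Suc a"] ya T by (simp add: algebra_simps)
  next
    case (Suc l)
    then show ?thesis
      using y_mid[of "a + k"] y_mid[of "Suc (a + k)"] that g by (simp add: algebra_simps)
  qed
  have "real (Suc a) * g \<le> real (N + Suc m + Suc J) * g"
    using g by (intro mult_right_mono) (auto simp: a_def)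
  then have "real (Suc a) * g \<le> 1" using Suc.prems by simp
  then have "T \<le> z a" using ya T by (simp add: y_def algebra_simps)
  note stage = forces_stage[OF s z(2) _ T(1) this v' y_def gap]
  have notin: "y j \<noteq> y a" if "Suc a \<le> j" "j \<le> Suc (a + m)" for j
  proof -
    have "real (Suc a) * g \<le> real j * g" using that g by (intro mult_right_mono) auto
    then show ?thesis using y_mid[OF that] ya T by (simp add: algebra_simps)
  qed
  have "y ` {Suc a..Suc a+m} \<subseteq> insert v (y ` {a..a+m} - {y a})"
  proof
    fix w assume "w \<in> y ` {Suc a..Suc a+m}"
    then obtain j where "Suc a \<le> j" "j \<le> Suc (a + m)" "w = y j" by auto
    then show "w \<in> insert v (y ` {a..a+m} - {y a})"
      using notin[of j] by (cases "j = Suc (a + m)") (auto simp: y_def)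
  qed
  then have "forces s (y ` {a..a+m}) y \<bar>y a - v\<bar> 0 (y ` {Suc a..Suc a+m}) y"
    using v by (intro forces_move) auto
  \<comment> \<open>The retreat has already shortened this distance by \<open>T\<close>, so the two
    offline moves add up to exactly \<open>(m + 1) * g\<close>.\<close>
  moreover have "\<bar>y a - v\<bar> = real (Suc m) * g - T"
  proof -
    have "y a - v = real (Suc m) * g - T" by (simp add: ya v_def algebra_simps)
    moreover have "1 * g \<le> real (Suc m) * g" using g by (intro mult_right_mono) auto
    then have "T \<le> real (Suc m) * g" using T by linarith
    ultimately show ?thesis by simp
  qed
  ultimately have forced: "forces s (x ` {N..N+m}) x
      (real J * (real (Suc m) * g) + T + (real (Suc m) * g - T))
      (real J + T * speed_sum s a (Suc m) + 0) (y ` {Suc a..Suc a+m}) y"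
    using z(1) stage(1) N by (intro forces_trans) (auto simp: a_def)
  \<comment> \<open>The last summand \<open>P\<close> of \<open>speed_sum\<close> alone yields
    \<open>T * P = v \<ge> 1\<close>.\<close>
  have gain: "1 \<le> T * speed_sum s a (Suc m)"
  proof -
    have "P \<le> speed_sum s a (Suc m)"
      unfolding speed_sum_Suc P_def using speed_sum_nonneg[of s a m] s N by (simp add: a_def)
    then have "T * P \<le> T * speed_sum s a (Suc m)" using T by (intro mult_left_mono) auto
    moreover have "T * P = v" using P1 by (simp add: T_def)
    ultimately show ?thesis using v by linarith
  qed
  have cost: "real J * (real (Suc m) * g) + T + (real (Suc m) * g - T) =
      real (Suc J) * (real (Suc m) * g)"
    by (simp add: algebra_simps)
  have "forces s (x ` {N..N+m}) x (real (Suc J) * (real (Suc m) * g)) (real (Suc J))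
      (y ` {N + Suc J..N + Suc J + m}) y"
    using gain by (intro forces_weaken[OF forced[unfolded cost]]) (simp_all add: a_def del: speed_sum.simps)
  moreover have "sorted_conf y" using stage(2) N by (simp add: a_def)
  moreover have "\<forall>i. N + Suc J + m < i \<longrightarrow> y i = 0" using zero by (simp add: y_def a_def)
  ultimately show ?case using y_mid by (intro exI[of _ y]) (auto simp: a_def)
qed

section \<open>The two regimes of speeds\<close>

lemma forces_ratio:
  assumes "forces s {} (\<lambda>_. 0) d a S' x'" "d \<le> D" "\<bar>R\<bar> * D + 1 \<le> a"
  shows "\<exists>\<sigma> d S'. serves {} \<sigma> d S' \<and> R * d + 1 \<le> ALG_DC s \<sigma>"
proof -
  obtain \<sigma> where \<sigma>: "serves {} \<sigma> d S'" "a \<le> ALG_DC s \<sigma>"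
    using assms(1) by (auto simp: forces_def ALG_DC_def)
  have "0 \<le> d" using OPT_bounds(1,2)[OF \<sigma>(1)] by simp
  then have "R * d \<le> \<bar>R\<bar> * d" by (intro mult_right_mono) auto
  also have "\<dots> \<le> \<bar>R\<bar> * D" using assms(2) by (intro mult_left_mono) auto
  finally show ?thesis using \<sigma> assms(3) by (intro exI[of _ \<sigma>] exI[of _ d] exI[of _ S']) auto
qed

text \<open>The quotient satisfies \<open>q (n+1) = q n / s (n+2) + 1\<close>, and
  \<open>1 / s j \<ge> 1 - \<epsilon>\<close> for late \<open>j\<close>. With
  \<open>K * \<epsilon> = 1 / 2\<close>, below \<open>K\<close> the loss
  \<open>q n * \<epsilon>\<close> is at most 1/2, so \<open>q\<close> gains at least 1/2 per step;
  once at \<open>K\<close> it stays there or above.\<close>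

lemma speed_ratio_unbounded:
  assumes s: "\<And>j. 2 \<le> j \<Longrightarrow> 1 \<le> s j" and lim: "\<And>\<epsilon>. 0 < \<epsilon> \<Longrightarrow> \<exists>N. \<forall>j\<ge>N. s j \<le> 1 + \<epsilon>"
    and K: "0 < K"
  shows "\<exists>N. \<forall>n\<ge>N. K \<le> speed_sum s 1 n / speed_prod s 1 n"
proof -
  define \<epsilon> where "\<epsilon> = 1 / (2 * K)"
  have \<epsilon>: "0 < \<epsilon>" "K * \<epsilon> = 1 / 2" using K by (auto simp: \<epsilon>_def)
  obtain N where N: "\<And>j. N \<le> j \<Longrightarrow> s j \<le> 1 + \<epsilon>" using lim[OF \<epsilon>(1)] by blast
  define q where "q n = speed_sum s 1 n / speed_prod s 1 n" for n
  have P: "1 \<le> speed_prod s 1 n" for n using s by (intro speed_prod_ge_1) auto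
  have q0: "0 \<le> q n" for n
    using speed_sum_nonneg[of s 1 n] P[of n] s unfolding q_def by (intro divide_nonneg_pos) auto
  have rec: "q (Suc n) = q n / s (Suc (1 + n)) + 1" for n
  proof -
    have "1 \<le> s (Suc (1 + n))" using s by simp
    with P[of n] show ?thesis
      unfolding q_def speed_sum_Suc speed_prod_Suc by (simp add: field_simps)
  qed
  have lower: "min K (real j / 2) \<le> q (N + j)" for j
  proof (induction j)
    case (Suc j)
    let ?s = "s (Suc (1 + (N + j)))"
    have s1: "1 \<le> ?s" "?s \<le> 1 + \<epsilon>" using s N by auto
    have "(1 - \<epsilon>) * ?s \<le> 1"
    proof (cases "\<epsilon> \<le> 1")
      case True
      then have "(1 - \<epsilon>) * ?s \<le> (1 - \<epsilon>) * (1 + \<epsilon>)" using s1 by (intro mult_left_mono) auto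
      also have "\<dots> \<le> 1" by (simp add: algebra_simps)
      finally show ?thesis .
    next
      case False
      then have "(1 - \<epsilon>) * ?s \<le> 0" using s1 by (intro mult_nonpos_nonneg) auto
      then show ?thesis by simp
    qed
    then have "1 - \<epsilon> \<le> 1 / ?s" using s1 by (simp add: pos_le_divide_eq)
    then have "q (N + j) * (1 - \<epsilon>) \<le> q (N + j) * (1 / ?s)" using q0 by (intro mult_left_mono)
    then have step: "q (N + j) * (1 - \<epsilon>) + 1 \<le> q (N + Suc j)" by (simp add: rec)
    show ?case
    proof (cases "K \<le> q (N + j)")
      case True
      show ?thesis
      proof (cases "\<epsilon> \<le> 1")
        case True
        then have "K * (1 - \<epsilon>) \<le> q (N + j) * (1 - \<epsilon>)"
          using \<open>K \<le> q (N + j)\<close> by (intro mult_right_mono) auto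
        then show ?thesis using step \<epsilon> by (simp add: algebra_simps)
      next
        case False
        then have "K \<le> 1" using \<epsilon> K by (simp add: \<epsilon>_def field_simps)
        moreover have "1 \<le> q (N + Suc j)" using s1 q0[of "N + j"] by (simp add: rec)
        ultimately show ?thesis by simp
      qed
    next
      case False
      then have "q (N + j) * \<epsilon> \<le> K * \<epsilon>" using \<epsilon> by (intro mult_right_mono) auto
      then have "q (N + j) + 1 / 2 \<le> q (N + Suc j)" using step \<epsilon> by (simp add: algebra_simps)
      then show ?thesis using Suc False by (auto simp: min_def split: if_splits)
    qed
  qed (use q0[of N] in \<open>simp add: min.coboundedI2\<close>)
  obtain j0 :: nat where j0: "2 * K \<le> j0" using real_arch_simple by blast
  have "K \<le> q n" if "N + j0 \<le> n" for n
  proof -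
    have "N + (n - N) = n" "j0 \<le> n - N" using that by auto
    then show ?thesis using lower[of "n - N"] j0 by (simp add: min_def split: if_splits)
  qed
  then show ?thesis unfolding q_def by blast
qed

lemma unbounded_ratio_if_speeds_tend_to_1:
  assumes s: "\<And>j. 2 \<le> j \<Longrightarrow> 1 \<le> s j" and lim: "\<And>\<epsilon>. 0 < \<epsilon> \<Longrightarrow> \<exists>N. \<forall>j\<ge>N. s j \<le> 1 + \<epsilon>"
  shows "\<exists>\<sigma> d S'. serves {} \<sigma> d S' \<and> R * d + 1 \<le> ALG_DC s \<sigma>"
proof -
  \<comment> \<open>The offline bound will be \<open>6 * n + 4 = 12 * N + 10\<close>, and the
    \<open>N + 1\<close> summands with \<open>N \<le> k \<le> 2 * N\<close> are at least
    \<open>K\<close> each.\<close>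
  define K where "K = 20 * \<bar>R\<bar> + 2"
  have K: "0 < K" by (simp add: K_def)
  let ?q = "\<lambda>k. speed_sum s 1 (Suc k) / speed_prod s 1 (Suc k)"
  obtain N where N: "\<And>n. N \<le> n \<Longrightarrow> K \<le> speed_sum s 1 n / speed_prod s 1 n"
    using speed_ratio_unbounded[OF s lim K] by blast
  define n where "n = 2 * N + 1"
  define M where "M = 2 * real n + 4"
  define g where "g = 1 / real (n + 1)"
  have "0 < g" "real (n + 1) * g \<le> 1" by (simp_all add: g_def)
  then obtain x d where x: "forces s {} (\<lambda>_. 0) d (\<Sum>k<n. ?q k) (x ` {1..1+n}) x"
    "d \<le> M + 4 * real n"
    using forces_spread[of s g n M] s by (auto simp: M_def)
  have "(\<Sum>k\<in>{N..<n}. K) \<le> (\<Sum>k\<in>{N..<n}. ?q k)"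
    using N by (intro sum_mono) (simp del: speed_sum.simps speed_prod.simps)
  also have "\<dots> \<le> (\<Sum>k<n. ?q k)"
  proof (intro sum_mono2)
    show "0 \<le> ?q k" for k
      using speed_sum_nonneg[of s 1 "Suc k"] speed_prod_ge_1[of s 1 "Suc k"] s
      by (intro divide_nonneg_pos) fastforce+
  qed auto
  finally have "real (N + 1) * K \<le> (\<Sum>k<n. ?q k)" by (simp add: n_def)
  moreover have "\<bar>R\<bar> * (M + 4 * real n) + 1 \<le> real (N + 1) * K"
    by (simp add: M_def n_def K_def algebra_simps)
  ultimately have "\<bar>R\<bar> * (M + 4 * real n) + 1 \<le> (\<Sum>k<n. ?q k)" by linarith
  with x show ?thesis by (rule forces_ratio)
qed

section \<open>Speeds bounded away from 1\<close>

lemma speed_prod_ge_power: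
  assumes "\<And>j. N \<le> j \<Longrightarrow> c \<le> s j" "0 \<le> c"
  shows "N \<le> a \<Longrightarrow> c ^ n \<le> speed_prod s a n"
proof (induction n arbitrary: a)
  case (Suc n)
  then have "c \<le> s (Suc a)" "c ^ n \<le> speed_prod s (Suc a) n" using assms by simp_all
  then show ?case using mult_mono[of c "s (Suc a)" "c ^ n"] assms by simp
qed simp

lemma power_dominates_linear:
  fixes c A B :: real
  assumes "1 < c"
  shows "\<exists>m. A * real (Suc m) + B \<le> c ^ Suc m"
proof -
  have "(\<lambda>n. A * (real n * (1 / c) ^ n) + B * (1 / c) ^ n) \<longlonglongrightarrow> A * 0 + B * 0"
    using assms by (intro tendsto_intros powser_times_n_limit_0 LIMSEQ_power_zero) auto
  then have "\<forall>\<^sub>F n in sequentially. A * (real n * (1 / c) ^ n) + B * (1 / c) ^ n < 1"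
    by (auto dest: order_tendstoD(2)[of _ _ _ 1])
  then obtain n0 where "\<And>n. n0 \<le> n \<Longrightarrow> A * (real n * (1 / c) ^ n) + B * (1 / c) ^ n < 1"
    by (auto simp: eventually_sequentially)
  from this[of "Suc n0"] have "(A * real (Suc n0) + B) / c ^ Suc n0 < 1"
    by (simp add: power_inverse add_divide_distrib divide_inverse algebra_simps del: power_Suc)
  then have "A * real (Suc n0) + B \<le> c ^ Suc n0"
    using assms by (simp add: pos_divide_less_eq del: power_Suc)
  then show ?thesis by blast
qed

lemma unbounded_ratio_if_speeds_exceed_1:
  assumes s: "\<And>j. 2 \<le> j \<Longrightarrow> 1 \<le> s j" and c: "1 < c" "\<And>j. N \<le> j \<Longrightarrow> c \<le> s j" and N: "2 \<le> N"
  shows "\<exists>\<sigma> d S'. serves {} \<sigma> d S' \<and> R * d + 1 \<le> ALG_DC s \<sigma>"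
proof -
  \<comment> \<open>The aim is \<open>\<bar>R\<bar> * (6 * N + 7 * h + 5) + 1 \<le> J\<close>, where
    \<open>J \<ge> 1 / g - N - h - 1\<close>; \<open>B\<close> collects the terms free of
    \<open>h\<close>.\<close>
  define B where "B = \<bar>R\<bar> * (6 * real N + 5) + real N + 2"
  obtain m where "4 * (7 * \<bar>R\<bar> + 1) * real (Suc m) + 4 * B \<le> c ^ Suc m"
    using power_dominates_linear[OF c(1)] by blast
  define h where "h = Suc m"
  \<comment> \<open>A retreat is at most \<open>2 / c ^ h\<close>, which is half of this
    spacing.\<close>
  define g where "g = 4 / c ^ h"
  have h: "(7 * \<bar>R\<bar> + 1) * real h + B \<le> c ^ h / 4"
    using \<open>4 * (7 * \<bar>R\<bar> + 1) * real (Suc m) + 4 * B \<le> c ^ Suc m\<close>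
    unfolding h_def by (simp add: algebra_simps del: power_Suc of_nat_Suc)
  have g: "0 < g" "1 / g = c ^ h / 4" using c by (simp_all add: g_def)
  \<comment> \<open>A number of slides for which all positions \<open>2 - i * g\<close> in use stay
    at or above 1.\<close>
  define J where "J = nat \<lfloor>1 / g - real (N + h)\<rfloor>"
  have "0 \<le> 7 * \<bar>R\<bar> * real h" "0 \<le> \<bar>R\<bar> * (6 * real N + 5)" by simp_all
  moreover have "7 * \<bar>R\<bar> * real h + real h + B \<le> 1 / g"
    using h unfolding g(2) by (simp only: distrib_right mult_1)
  ultimately have "real (N + h) \<le> 1 / g" unfolding B_def by linarith
  then have J: "real J \<le> 1 / g - real (N + h)" "1 / g - real (N + h) - 1 \<le> real J"
    unfolding J_def by linarith+
  have NhJ: "real (N + h + J) * g \<le> 1"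
    using J(1) g(1) by (simp add: pos_le_divide_eq algebra_simps)
  \<comment> \<open>Spreading must stop with server \<open>N + m\<close>, the left end of the first
    window.\<close>
  define n where "n = N + h - 2"
  have n: "1 + n = N + m" using N by (simp add: n_def h_def)
  have "real (n + 1) * g \<le> real (N + h + J) * g"
    using g n by (intro mult_right_mono) (auto simp: h_def)
  then have ng: "real (n + 1) * g \<le> 1" using NhJ by simp
  define M where "M = 2 * real n + 4"
  let ?q = "\<Sum>k<n. speed_sum s 1 (Suc k) / speed_prod s 1 (Suc k)"
  have "2 * real n + 4 \<le> M" by (simp add: M_def)
  from forces_spread[of s g n M, OF s g(1) ng this] obtain x d where
    x: "forces s {} (\<lambda>_. 0) d ?q (x ` {1..1+n}) x" "sorted_conf x" "d \<le> M + 4 * real n"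
    and mid: "\<And>i. 2 \<le> i \<Longrightarrow> i \<le> 1 + n \<Longrightarrow> x i = 2 - real i * g"
    and zero: "\<And>i. 1 + n < i \<Longrightarrow> x i = 0"
    by (auto simp del: speed_sum.simps speed_prod.simps)
  have "0 \<le> ?q"
  proof (intro sum_nonneg)
    show "0 \<le> speed_sum s 1 (Suc k) / speed_prod s 1 (Suc k)" for k
      using speed_sum_nonneg[of s 1 "Suc k"] speed_prod_ge_1[of s 1 "Suc k"] s
      by (intro divide_nonneg_pos) fastforce+
  qed
  moreover have "x ` {N..N+m} \<subseteq> x ` {1..1+n}" unfolding n using N by auto
  ultimately have first: "forces s {} (\<lambda>_. 0) d 0 (x ` {N..N+m}) x"
    by (rule forces_weaken[OF x(1)])
  have "2 / speed_prod s a (Suc m) < g" if "N \<le> a" for a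
  proof -
    have "c ^ h \<le> speed_prod s a (Suc m)"
      using speed_prod_ge_power[of N c s a "Suc m"] c that by (simp add: h_def)
    moreover have "0 < c ^ h" using c by simp
    ultimately have "2 / speed_prod s a (Suc m) \<le> 2 / c ^ h" by (intro divide_left_mono) auto
    also have "\<dots> < g" using c by (simp add: g_def divide_strict_right_mono)
    finally show ?thesis .
  qed
  then have "\<exists>y. forces s (x ` {N..N+m}) x (real J * (real (Suc m) * g)) (real J)
      (y ` {N+J..N+J+m}) y"
    using forces_slide[of s g N m J x] s g(1) NhJ N x(2) mid zero n by (auto simp: h_def)
  then obtain y where "forces s (x ` {N..N+m}) x (real J * (real h * g)) (real J)
      (y ` {N+J..N+J+m}) y" by (auto simp: h_def)
  note total = forces_trans[OF first this]
  have "real J * g \<le> 1"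
  proof -
    have "real J * g \<le> real (N + h + J) * g" using g by (intro mult_right_mono) auto
    then show ?thesis using NhJ by simp
  qed
  then have "real h * (real J * g) \<le> real h * 1" by (intro mult_left_mono) auto
  then have D: "d + real J * (real h * g) \<le> 6 * real N + 7 * real h + 5"
    using x(3) N by (simp add: M_def n_def mult_ac of_nat_diff)
  have "\<bar>R\<bar> * (6 * real N + 7 * real h + 5) + 1 \<le> 0 + real J"
    using J(2) h unfolding g(2) B_def by (simp add: algebra_simps)
  from forces_ratio[OF total D this] show ?thesis .
qed

theorem theorem9:
  fixes s :: "nat \<Rightarrow> real"
  assumes "\<forall>i\<ge>2. 1 \<le> s i"
    and "(\<forall>i j. 2 \<le> i \<longrightarrow> i \<le> j \<longrightarrow> s i \<le> s j) \<or> (\<forall>i j. 2 \<le> i \<longrightarrow> i \<le> j \<longrightarrow> s j \<le> s i)"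
  shows "\<not> competitive (ALG_DC s)"
proof (rule not_competitive_if_unbounded_ratio)
  fix R
  have s: "1 \<le> s j" if "2 \<le> j" for j using assms(1) that by blast
  show "\<exists>\<sigma> d S'. serves {} \<sigma> d S' \<and> R * d + 1 \<le> ALG_DC s \<sigma>"
  proof (cases "\<forall>\<epsilon>>0. \<exists>N. \<forall>j\<ge>N. s j \<le> 1 + \<epsilon>")
    case True
    then show ?thesis using s by (intro unbounded_ratio_if_speeds_tend_to_1) auto
  next
    case False
    then obtain \<epsilon> where \<epsilon>: "0 < \<epsilon>" "\<And>N. \<exists>j\<ge>N. 1 + \<epsilon> < s j" by (auto simp: not_le)
    \<comment> \<open>In a non-decreasing sequence one large value bounds all later ones from below;
      in a non-increasing one, arbitrarily late large values bound all earlier ones.\<close>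
    from assms(2) have "\<exists>N\<ge>2. \<forall>j\<ge>N. 1 + \<epsilon> \<le> s j"
    proof
      assume mono: "\<forall>i j. 2 \<le> i \<longrightarrow> i \<le> j \<longrightarrow> s i \<le> s j"
      obtain N where "2 \<le> N" "1 + \<epsilon> < s N" using \<epsilon>(2) by blast
      with mono show ?thesis by (intro exI[of _ N]) fastforce
    next
      assume anti: "\<forall>i j. 2 \<le> i \<longrightarrow> i \<le> j \<longrightarrow> s j \<le> s i"
      have "1 + \<epsilon> \<le> s i" if "2 \<le> i" for i
      proof -
        obtain j where "i \<le> j" "1 + \<epsilon> < s j" using \<epsilon>(2) by blast
        then show ?thesis using anti that by fastforce
      qed
      then show ?thesis by blast
    qed
    then obtain N where "2 \<le> N" "\<And>j. N \<le> j \<Longrightarrow> 1 + \<epsilon> \<le> s j" by blast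
    then show ?thesis using s \<epsilon>(1) by (intro unbounded_ratio_if_speeds_exceed_1[of s "1 + \<epsilon>" N]) auto
  qed
qed

end
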